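(* For any non-negative integer $N$, as formal power series in independent variables $q,a,b,t$, \[ \sum_{k\geq 0 }\frac{(bt)^kq^{k(k+1)/2}}{(atq;q)_k} {N\brack k}_q \;=\; \sum_{m\geq 0} (bt)^mq^{m(m+1)/2}\,(-btq^{m+1};q)_{N-m}\, \frac{(at)^mq^{m^2}}{(atq;q)_m} {N\brack m}_q. \]
   Context: For $n\in\mathbb{Z}_{\ge0}$, $(c;q)_n=\prod_{i=0}^{n-1}(1-cq^i)$. The Gaussian coefficient is ${a+b\brack b}_q=\frac{(q;q)_{a+b}}{(q;q)_a(q;q)_b}$ if $a,b\ge 0$ are integers and $0$ otherwise; in particular all terms with $k>N$ or $m>N$ vanish. *)

theory Defs
  imports "HOL-Computational_Algebra.Formal_Power_Series"
begin

unbundle fps_syntax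

text \<open>
  The ring \<open>k[[q,a,b,t]]\<close> is represented as \<open>k[[q]][[a]][[b]][[t]]\<close>: the outermost
  series is in \<open>t\<close>, the innermost in \<open>q\<close>.  The inverse and quotient on \<^typ>\<open>'k fps\<close> are
  defined recursively through the constant term, so on the iterated type they are the ring
  inverse and quotient whenever the total constant term of the denominator is non-zero
  (see \<open>ps4_inverse\<close> and \<open>ps4_divide\<close> below).
\<close>

type_synonym 'k ps4 = "'k fps fps fps fps"

definition var_q :: "'k::field ps4" where
  "var_q = fps_const (fps_const (fps_const fps_X))"

definition var_a :: "'k::field ps4" where
  "var_a = fps_const (fps_const fps_X)"

definition var_b :: "'k::field ps4" where
  "var_b = fps_const fps_X"

definition var_t :: "'k::field ps4" where
  "var_t = fps_X"

definition qpoch :: "'r::comm_ring_1 \<Rightarrow> 'r \<Rightarrow> nat \<Rightarrow> 'r" where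
  "qpoch c q n = (\<Prod>i<n. 1 - c * q ^ i)"

text \<open>\<open>qbinom q n k\<close> is the Gaussian coefficient with upper entry \<open>n\<close> and lower entry \<open>k\<close>.\<close>

definition qbinom :: "'r::{comm_ring_1,inverse} \<Rightarrow> nat \<Rightarrow> nat \<Rightarrow> 'r" where
  "qbinom q n k =
     (if k \<le> n then qpoch q q n / (qpoch q q (n - k) * qpoch q q k) else 0)"

lemma fps_inverse_mult_self:
  fixes f :: "'r::{comm_ring_1,inverse} fps"
  assumes "inverse (f $ 0) * f $ 0 = 1"
  shows "inverse f * f = 1"
  using fps_right_inverse[of f "inverse (f $ 0)"] assms
  by (simp add: fps_inverse_def mult.commute)

lemma ps4_inverse:
  fixes f :: "'k::field ps4"
  assumes "f $ 0 $ 0 $ 0 $ 0 \<noteq> 0"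
  shows "inverse f * f = 1"
  using assms by (intro fps_inverse_mult_self) simp

lemma ps4_divide:
  fixes f g :: "'k::field ps4"
  assumes "g $ 0 $ 0 $ 0 $ 0 \<noteq> 0"
  shows "f / g = f * inverse g" and "f / g * g = f"
proof -
  have "g $ 0 \<noteq> 0" using assms by auto
  then show *: "f / g = f * inverse g" by (rule fps_divide_unit)
  show "f / g * g = f"
    by (simp add: * mult.assoc ps4_inverse[OF assms])
qed

lemma qpoch_constant_term:
  "qpoch (var_a * var_t * var_q) var_q n $ 0 $ 0 $ 0 $ 0 = (1 :: 'k::field)"
  "qpoch var_q var_q n $ 0 $ 0 $ 0 $ 0 = (1 :: 'k::field)"
proof -
  have *: "qpoch c d n $ 0 $ 0 $ 0 $ 0 = 1" if "c $ 0 $ 0 $ 0 $ 0 = 0" for c d :: "'k ps4"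
    unfolding qpoch_def using that by (induction n) simp_all
  show "qpoch (var_a * var_t * var_q) var_q n $ 0 $ 0 $ 0 $ 0 = (1 :: 'k)"
       "qpoch var_q var_q n $ 0 $ 0 $ 0 $ 0 = (1 :: 'k)"
    by (simp_all add: * var_q_def var_t_def)
qed

end

theory Submission
  imports Defs
begin

text \<open>
  Write \<open>x = at\<close> and \<open>y = bt\<close>.  Expanding \<open>(-yq\<^bsup>m+1\<^esup>;q)\<^bsub>N-m\<^esub>\<close> on the right by the
  \<open>q\<close>-binomial theorem and using \<open>[N,m][N-m,k-m] = [N,k][k,m]\<close>, the coefficient of \<open>y\<^sup>k\<close>
  reduces to \<open>1/(xq;q)\<^sub>k = \<Sum>\<^sub>m x\<^sup>m q\<^bsup>m*m\<^esup> [k,m] / (xq;q)\<^sub>m\<close>.  After multiplication by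
  \<open>(xq;q)\<^sub>k\<close> the sum becomes polynomial, and it is identically \<open>1\<close> by induction on \<open>k\<close>: the
  Pascal recurrence gives \<open>S\<^bsub>k+1\<^esub>(x) = (1 - xq\<^bsup>k+1\<^esup>) S\<^sub>k(x) + xq\<^bsup>k+1\<^esup> S\<^sub>k(xq)\<close>.
\<close>

lemma qpoch_0 [simp]: "qpoch c q 0 = 1"
  by (simp add: qpoch_def)

lemma qpoch_Suc: "qpoch c q (Suc n) = qpoch c q n * (1 - c * q ^ n)"
  by (simp add: qpoch_def)

lemma qpoch_add: "qpoch c q (m + n) = qpoch c q m * qpoch (c * q ^ m) q n"
  by (induction n) (simp_all add: qpoch_Suc power_add mult.assoc)

text \<open>Building the Gaussian coefficient from a Pascal recurrence avoids division, so the sum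
  identities can be proved by induction over any commutative ring. The truncated
  \<open>n - k\<close> is harmless: for \<open>k > n\<close> its factor \<open>gauss q n k\<close>
  vanishes.\<close>

fun gauss :: "'r::comm_ring_1 \<Rightarrow> nat \<Rightarrow> nat \<Rightarrow> 'r" where
  "gauss q n 0 = 1"
| "gauss q 0 (Suc k) = 0"
| "gauss q (Suc n) (Suc k) = gauss q n (Suc k) + q ^ (n - k) * gauss q n k"

lemma gauss_eq_0: "n < k \<Longrightarrow> gauss q n k = 0"
  by (induction q n k rule: gauss.induct) auto

text \<open>The two Pascal terms contribute \<open>1 - q^(n-k)\<close> and
  \<open>q^(n-k) * (1 - q^(k+1))\<close> times \<open>qpoch q q n\<close>; these factors add up to
  \<open>1 - q^(n+1)\<close>.\<close>

lemma gauss_qpoch: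
  "k \<le> n \<Longrightarrow> gauss q n k * (qpoch q q (n - k) * qpoch q q k) = qpoch q q n"
proof (induction q n k rule: gauss.induct)
  case (3 q n k)
  have right: "gauss q n k * (qpoch q q (n - k) * qpoch q q k) = qpoch q q n"
    using 3 by simp
  have left: "gauss q n (Suc k) * (qpoch q q (n - k) * qpoch q q (Suc k))
      = (1 - q ^ (n - k)) * qpoch q q n"
  proof (cases "Suc k \<le> n")
    case True
    then have "n - k = Suc (n - Suc k)" by simp
    then have "qpoch q q (n - k) = qpoch q q (n - Suc k) * (1 - q ^ (n - k))"
      by (simp add: qpoch_Suc)
    then have "gauss q n (Suc k) * (qpoch q q (n - k) * qpoch q q (Suc k))
        = (1 - q ^ (n - k)) * (gauss q n (Suc k) * (qpoch q q (n - Suc k) * qpoch q q (Suc k)))"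
      by (simp only: mult_ac)
    then show ?thesis
      unfolding 3(1)[OF True] .
  next
    case False
    \<comment> \<open>Here \<open>k = n\<close>, so both sides vanish: the left through
      \<open>gauss\<close>, the right through \<open>1 - q^0\<close>.\<close>
    then show ?thesis using 3(3) by (simp add: gauss_eq_0)
  qed
  have "gauss q (Suc n) (Suc k) * (qpoch q q (Suc n - Suc k) * qpoch q q (Suc k))
      = gauss q n (Suc k) * (qpoch q q (n - k) * qpoch q q (Suc k))
        + q ^ (n - k) * (1 - q ^ Suc k) * (gauss q n k * (qpoch q q (n - k) * qpoch q q k))"
    by (simp add: qpoch_Suc algebra_simps)
  also have "\<dots> = (1 - q ^ (n - k + Suc k)) * qpoch q q n"
    unfolding left right power_add by (simp add: algebra_simps)
  also have "\<dots> = qpoch q q (Suc n)"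
    using 3(3) by (simp add: qpoch_Suc mult.commute)
  finally show ?case .
qed simp_all

text \<open>Multiplied by the three q-factorials of \<open>n - k\<close>, \<open>k - m\<close> and
  \<open>m\<close>, both sides become \<open>qpoch q q n\<close>; these factors cancel in an
  integral domain.\<close>

lemma gauss_trinomial_revision:
  fixes q :: "'r::idom"
  assumes nz: "\<And>n. qpoch q q n \<noteq> 0" and "m \<le> k" "k \<le> n"
  shows "gauss q n m * gauss q (n - m) (k - m) = gauss q n k * gauss q k m"
proof -
  let ?P = "qpoch q q"
  have "gauss q n m * gauss q (n - m) (k - m) * (?P (n - k) * ?P (k - m) * ?P m)
      = gauss q n m * (gauss q (n - m) (k - m) * (?P (n - m - (k - m)) * ?P (k - m)) * ?P m)"
    using assms by (simp add: mult_ac)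
  also have "\<dots> = ?P n"
    using assms gauss_qpoch[of "k - m" "n - m" q] by (simp add: gauss_qpoch)
  also have "\<dots> = gauss q n k * (?P (n - k) * (gauss q k m * (?P (k - m) * ?P m)))"
    using assms by (simp add: gauss_qpoch)
  also have "\<dots> = gauss q n k * gauss q k m * (?P (n - k) * ?P (k - m) * ?P m)"
    by (simp add: mult_ac)
  finally show ?thesis
    using nz by simp
qed

text \<open>Pascal's rule summed against an arbitrary weight: the common inductive step of
  \<open>q_binomial\<close> and \<open>durfee_sum_polynomial\<close>.\<close>

lemma sum_gauss_Suc:
  "(\<Sum>j\<le>Suc n. gauss q (Suc n) j * f j)
   = (\<Sum>j\<le>n. gauss q n j * f j) + (\<Sum>j\<le>n. q ^ (n - j) * gauss q n j * f (Suc j))"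
proof -
  have "(\<Sum>j\<le>Suc n. gauss q (Suc n) j * f j)
      = f 0 + (\<Sum>j\<le>n. gauss q n (Suc j) * f (Suc j))
        + (\<Sum>j\<le>n. q ^ (n - j) * gauss q n j * f (Suc j))"
    by (subst sum.atMost_Suc_shift) (simp add: algebra_simps sum.distrib)
  also have "f 0 + (\<Sum>j\<le>n. gauss q n (Suc j) * f (Suc j)) = (\<Sum>j\<le>Suc n. gauss q n j * f j)"
    by (subst sum.atMost_Suc_shift) simp
  also have "\<dots> = (\<Sum>j\<le>n. gauss q n j * f j)"
    by (simp add: gauss_eq_0)
  finally show ?thesis .
qed

lemma triangle_Suc: "Suc j * Suc (Suc j) div 2 = j * (j + 1) div 2 + Suc j"
proof -
  have "Suc j * Suc (Suc j) = j * (j + 1) + Suc j * 2" by simp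
  then show ?thesis by simp
qed

lemma q_binomial:
  "qpoch (- (z * q)) q n = (\<Sum>j\<le>n. gauss q n j * (z ^ j * q ^ (j * (j + 1) div 2)))"
proof (induction n)
  case (Suc n)
  let ?f = "\<lambda>j. z ^ j * q ^ (j * (j + 1) div 2)"
  \<comment> \<open>The second Pascal sum is thus \<open>z * q^(n+1)\<close> times the first, which
    supplies the new factor \<open>1 + z * q^(n+1)\<close>.\<close>
  have shift: "q ^ (n - j) * gauss q n j * ?f (Suc j) = z * q ^ Suc n * (gauss q n j * ?f j)"
    if "j \<le> n" for j
  proof -
    have "q ^ (n - j) * ?f (Suc j) = z * z ^ j * q ^ (n - j + (j * (j + 1) div 2 + Suc j))"
      using triangle_Suc[of j] by (simp add: power_add mult_ac del: mult_Suc mult_Suc_right)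
    also have "n - j + (j * (j + 1) div 2 + Suc j) = Suc n + j * (j + 1) div 2"
      using that by simp
    finally have "q ^ (n - j) * ?f (Suc j) = z * q ^ Suc n * ?f j"
      by (simp only: power_add mult_ac)
    then have "gauss q n j * (q ^ (n - j) * ?f (Suc j)) = gauss q n j * (z * q ^ Suc n * ?f j)"
      by (rule arg_cong)
    then show ?thesis
      by (simp only: mult_ac)
  qed
  show ?case
    unfolding sum_gauss_Suc using shift Suc
    by (simp add: qpoch_Suc sum_distrib_left [symmetric] algebra_simps)
qed simp

text \<open>Cleared of denominators, this is the Durfee square dissection of partitions into parts
  at most \<open>k\<close>, with \<open>x\<close> marking the number of parts and \<open>m\<close>
  the side of the square.\<close>

lemma durfee_sum_polynomial:
  "(\<Sum>m\<le>k. gauss q k m * (x ^ m * q ^ (m ^ 2) * qpoch (x * q ^ (m + 1)) q (k - m))) = 1"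
\<comment> \<open>\<open>x\<close> is generalised because the second Pascal sum is the same sum at
  \<open>x * q\<close>.\<close>
proof (induction k arbitrary: x)
  case (Suc k)
  let ?f = "\<lambda>k x m. x ^ m * q ^ (m ^ 2) * qpoch (x * q ^ (m + 1)) q (k - m)"
  have keep: "?f (Suc k) x m = (1 - x * q ^ Suc k) * ?f k x m" if "m \<le> k" for m
  proof -
    have "x * q ^ (m + 1) * q ^ (k - m) = x * q ^ (m + 1 + (k - m))"
      by (simp only: power_add mult_ac)
    also have "m + 1 + (k - m) = Suc k"
      using that by simp
    finally have "qpoch (x * q ^ (m + 1)) q (Suc k - m)
        = qpoch (x * q ^ (m + 1)) q (k - m) * (1 - x * q ^ Suc k)"
      using that by (simp only: Suc_diff_le qpoch_Suc)
    then show ?thesis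
      by (simp only: mult_ac)
  qed
  have shift: "q ^ (k - m) * gauss q k m * ?f (Suc k) x (Suc m)
      = x * q ^ Suc k * (gauss q k m * ?f k (x * q) m)" if "m \<le> k" for m
  proof -
    have "q ^ (k - m) * (x ^ Suc m * q ^ ((Suc m)\<^sup>2)) = x * x ^ m * q ^ (k - m + (Suc m)\<^sup>2)"
      by (simp add: power_add mult_ac)
    \<comment> \<open>Of this exponent, \<open>m\<close> turns \<open>x^m\<close> into
      \<open>(x * q)^m\<close>, and \<open>Suc k\<close> goes into the prefactor.\<close>
    also have "k - m + (Suc m)\<^sup>2 = Suc k + m + m\<^sup>2"
      using that by (simp add: power2_eq_square)
    finally have "q ^ (k - m) * (x ^ Suc m * q ^ ((Suc m)\<^sup>2))
        = x * q ^ Suc k * ((x * q) ^ m * q ^ (m\<^sup>2))"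
      by (simp only: power_add power_mult_distrib mult_ac)
    moreover have "x * q ^ (Suc m + 1) = x * q * q ^ (m + 1)"
      by (simp add: mult_ac)
    ultimately have "q ^ (k - m) * ?f (Suc k) x (Suc m) = x * q ^ Suc k * ?f k (x * q) m"
      by (simp only: diff_Suc_Suc mult.assoc [symmetric])
    then have "gauss q k m * (q ^ (k - m) * ?f (Suc k) x (Suc m))
        = gauss q k m * (x * q ^ Suc k * ?f k (x * q) m)"
      by (rule arg_cong)
    then show ?thesis
      by (simp only: mult_ac)
  qed
  have "(\<Sum>m\<le>k. gauss q k m * ?f (Suc k) x m)
      = (1 - x * q ^ Suc k) * (\<Sum>m\<le>k. gauss q k m * ?f k x m)"
    unfolding sum_distrib_left
    by (intro sum.cong refl) (simp only: keep atMost_iff, simp only: mult_ac)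
  moreover have "(\<Sum>m\<le>k. q ^ (k - m) * gauss q k m * ?f (Suc k) x (Suc m))
      = x * q ^ Suc k * (\<Sum>m\<le>k. gauss q k m * ?f k (x * q) m)"
    unfolding sum_distrib_left by (intro sum.cong refl shift) simp
  ultimately show ?case
    unfolding sum_gauss_Suc by (simp only: Suc.IH) simp
qed simp

text \<open>Here and below \<open>v k\<close> plays the role of \<open>1 / qpoch (x * q) q k\<close>.\<close>

lemma durfee_sum:
  assumes v: "\<And>k. qpoch (x * q) q k * v k = 1"
  shows "(\<Sum>m\<le>k. gauss q k m * (x ^ m * q ^ (m ^ 2) * v m)) = v k"
proof -
  \<comment> \<open>Passing to the common denominator introduces the factors of index
    \<open>m+1\<close> to \<open>k\<close>.\<close>
  have v_eq: "v m = qpoch (x * q ^ (m + 1)) q (k - m) * v k" if "m \<le> k" for m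
  proof -
    have "qpoch (x * q) q k = qpoch (x * q) q m * qpoch (x * q ^ (m + 1)) q (k - m)"
      using that qpoch_add[of "x * q" q m "k - m"] by (simp add: mult_ac)
    then have "v m = v m * (qpoch (x * q) q m * qpoch (x * q ^ (m + 1)) q (k - m) * v k)"
      using v[of k] by simp
    also have "\<dots> = qpoch (x * q) q m * v m * (qpoch (x * q ^ (m + 1)) q (k - m) * v k)"
      by (simp add: mult_ac)
    finally show ?thesis
      using v[of m] by simp
  qed
  have "(\<Sum>m\<le>k. gauss q k m * (x ^ m * q ^ (m ^ 2) * v m))
      = (\<Sum>m\<le>k. gauss q k m * (x ^ m * q ^ (m ^ 2) * qpoch (x * q ^ (m + 1)) q (k - m))) * v k"
    unfolding sum_distrib_right
  proof (intro sum.cong refl)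
    fix m assume "m \<in> {..k}"
    then have "m \<le> k" by simp
    show "gauss q k m * (x ^ m * q ^ (m ^ 2) * v m)
        = gauss q k m * (x ^ m * q ^ (m ^ 2) * qpoch (x * q ^ (m + 1)) q (k - m)) * v k"
      unfolding v_eq[OF \<open>m \<le> k\<close>] by (simp only: mult_ac)
  qed
  then show ?thesis
    by (simp only: durfee_sum_polynomial) simp
qed

text \<open>The cross term \<open>m * j\<close> is what replaces \<open>y\<close> by
  \<open>y * q^m\<close> when the triangular weight is shifted by \<open>m\<close>.\<close>

lemma triangle_add: "(m + j) * (m + j + 1) div 2 = m * (m + 1) div 2 + (m * j + j * (j + 1) div 2)"
  for m j :: nat
proof -
  have "even (m * (m + 1))" "even (j * (j + 1))" by auto
  moreover have "(m + j) * (m + j + 1) = m * (m + 1) + (2 * (m * j) + j * (j + 1))"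
    by (simp add: algebra_simps)
  ultimately show ?thesis by (simp only: div_plus_div_distrib_dvd_left)
qed

lemma gauss_sum_transformation:
  fixes q x y :: "'r::idom"
  assumes nz: "\<And>n. qpoch q q n \<noteq> 0"
    and v: "\<And>k. qpoch (x * q) q k * v k = 1"
  shows "(\<Sum>k\<le>N. y ^ k * q ^ (k * (k + 1) div 2) * v k * gauss q N k)
    = (\<Sum>m\<le>N. y ^ m * q ^ (m * (m + 1) div 2) * qpoch (- (y * q ^ (m + 1))) q (N - m)
        * (x ^ m * q ^ (m ^ 2) * v m) * gauss q N m)"
proof -
  define T where "T k = y ^ k * q ^ (k * (k + 1) div 2)" for k
  define w where "w m = x ^ m * q ^ (m ^ 2) * v m" for m
  have T_add: "T (m + j) = T m * ((y * q ^ m) ^ j * q ^ (j * (j + 1) div 2))" for m j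
    unfolding T_def triangle_add
    by (simp only: power_add power_mult_distrib mult_ac flip: power_mult)
  \<comment> \<open>The q-binomial theorem at \<open>z = y * q^m\<close>, reindexed by
    \<open>k = m + j\<close>, followed by trinomial revision.\<close>
  have row: "T m * qpoch (- (y * q ^ (m + 1))) q (N - m) * gauss q N m
      = (\<Sum>k=m..N. T k * (gauss q N k * gauss q k m))" if "m \<le> N" for m
  proof -
    have "qpoch (- (y * q ^ (m + 1))) q (N - m) = qpoch (- (y * q ^ m * q)) q (N - m)"
      by (simp add: mult_ac)
    then have "T m * qpoch (- (y * q ^ (m + 1))) q (N - m) * gauss q N m
        = (\<Sum>j\<le>N - m. T (m + j) * (gauss q N m * gauss q (N - m) j))"
      unfolding q_binomial T_add by (simp only: sum_distrib_left sum_distrib_right mult_ac)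
    also have "\<dots> = (\<Sum>k=m..N. T k * (gauss q N m * gauss q (N - m) (k - m)))"
      by (rule sum.reindex_bij_witness[where i = "\<lambda>k. k - m" and j = "\<lambda>j. m + j"])
        (use that in auto)
    also have "\<dots> = (\<Sum>k=m..N. T k * (gauss q N k * gauss q k m))"
      by (intro sum.cong refl) (simp add: gauss_trinomial_revision[OF nz])
    finally show ?thesis .
  qed
  have "(\<Sum>k\<le>N. T k * v k * gauss q N k)
      = (\<Sum>k\<le>N. \<Sum>m\<le>k. T k * (gauss q N k * gauss q k m) * w m)"
  proof (intro sum.cong refl)
    fix k
    have "T k * v k * gauss q N k = T k * gauss q N k * (\<Sum>m\<le>k. gauss q k m * w m)"
      unfolding w_def durfee_sum[OF v] by (simp only: mult_ac)
    then show "T k * v k * gauss q N k = (\<Sum>m\<le>k. T k * (gauss q N k * gauss q k m) * w m)"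
      by (simp only: sum_distrib_left mult_ac)
  qed
  \<comment> \<open>Interchange of summation over the triangle
    \<open>m \<le> k \<le> N\<close>.\<close>
  also have "\<dots> = (\<Sum>m\<le>N. \<Sum>k=m..N. T k * (gauss q N k * gauss q k m) * w m)"
    unfolding sum.Sigma[OF finite_atMost ballI[OF finite_atMost]]
      sum.Sigma[OF finite_atMost ballI[OF finite_atLeastAtMost]]
    by (rule sum.reindex_bij_witness[where i = "\<lambda>(m, k). (k, m)" and j = "\<lambda>(k, m). (m, k)"])
      auto
  also have "\<dots> = (\<Sum>m\<le>N. T m * qpoch (- (y * q ^ (m + 1))) q (N - m) * w m * gauss q N m)"
  proof (intro sum.cong refl)
    fix m assume "m \<in> {..N}"
    then have m: "m \<le> N" by simp
    have "(\<Sum>k=m..N. T k * (gauss q N k * gauss q k m) * w m)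
        = T m * qpoch (- (y * q ^ (m + 1))) q (N - m) * gauss q N m * w m"
      unfolding row[OF m] by (rule sum_distrib_right [symmetric])
    then show "(\<Sum>k=m..N. T k * (gauss q N k * gauss q k m) * w m)
        = T m * qpoch (- (y * q ^ (m + 1))) q (N - m) * w m * gauss q N m"
      by (simp only: mult_ac)
  qed
  finally show ?thesis
    unfolding T_def w_def .
qed

lemma qpoch_var_q_nonzero: "qpoch var_q var_q n \<noteq> (0 :: 'k::field ps4)"
  using qpoch_constant_term(2)[of n, where 'k = 'k] by auto

text \<open>The quotient and the recursive form agree after multiplication by the denominator, which
  is nonzero because its constant term is 1.\<close>

lemma qbinom_var_q: "qbinom var_q n k = (gauss var_q n k :: 'k::field ps4)"
proof (cases "k \<le> n")
  case True
  let ?d = "qpoch var_q var_q (n - k) * qpoch var_q var_q k :: 'k ps4"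
  have "qbinom var_q n k * ?d = gauss var_q n k * ?d"
    unfolding gauss_qpoch[OF True] using True
    by (simp add: qbinom_def ps4_divide(2) qpoch_constant_term)
  then show ?thesis
    by (simp add: qpoch_var_q_nonzero)
qed (simp add: qbinom_def gauss_eq_0)

theorem theorem7:
  fixes N :: nat and q a b t :: "'k::field ps4"
  defines "q \<equiv> var_q" and "a \<equiv> var_a" and "b \<equiv> var_b" and "t \<equiv> var_t"
  shows
    "(\<Sum>k. (b * t) ^ k * q ^ (k * (k + 1) div 2) / qpoch (a * t * q) q k * qbinom q N k) =
     (\<Sum>m. (b * t) ^ m * q ^ (m * (m + 1) div 2) * qpoch (- (b * t * q ^ (m + 1))) q (N - m)
            * ((a * t) ^ m * q ^ (m ^ 2) / qpoch (a * t * q) q m) * qbinom q N m)"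
proof -
  define v where "v k = inverse (qpoch (a * t * q) q k)" for k
  have unit: "qpoch (a * t * q) q k $ 0 $ 0 $ 0 $ 0 \<noteq> 0" for k
    unfolding a_def t_def q_def by (simp add: qpoch_constant_term)
  have v: "qpoch (a * t * q) q k * v k = 1" for k
    using ps4_inverse[OF unit] by (simp add: v_def mult.commute)
  have div: "f / qpoch (a * t * q) q k = f * v k" for f k
    unfolding v_def by (rule ps4_divide(1)[OF unit])
  \<comment> \<open>The summands vanish for \<open>k > N\<close>, so both series are finite sums and
    no convergence argument arises.\<close>
  have fin: "(\<Sum>k. f k * gauss q N k) = (\<Sum>k\<le>N. f k * gauss q N k)" for f
    by (rule suminf_finite) (simp_all add: gauss_eq_0)
  have binom: "qbinom q N k = gauss q N k" for k
    unfolding q_def by (rule qbinom_var_q)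
  show ?thesis
    unfolding div binom fin
    by (rule gauss_sum_transformation[OF _ v]) (simp add: q_def qpoch_var_q_nonzero)
qed

end
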